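(* Let $\delta>0$. Let $u_\delta$ be the solution of the periodic Riemann problem for the linearised Intermediate Long Wave equation and let $u_{BO}$ be the solution of the periodic Riemann problem for the linearised Benjamin--Ono equation, i.e. $$u_\delta(t,x)=\frac12+\frac2\pi\sum_{k=0}^\infty\frac{\sin\left[(2k+1)x-\omega_\delta(2k+1)t\right]}{2k+1},\qquad u_{BO}(t,x)=\frac12+\frac2\pi\sum_{k=0}^\infty\frac{\sin\left[(2k+1)x-(2k+1)^2t\right]}{2k+1},$$ where $\omega_\delta(k)=k^2\coth(\delta k)-k/\delta$. Define $v$ by $$u_\delta(t,x)=u_{BO}\left(t,x+\frac t\delta\right)+v(t,x).$$ Then for each fixed $t\ge 0$ the Fourier coefficients of $v(t,\cdot)$ decay exponentially fast to $0$ as $|k|\to\infty$, and hence $v(t,\cdot)$ is a $C^\infty$ function. Moreover, at every rational time $t=\pi p/q$, with $p,q$ positive integers, for almost every $x$, $$(u_\delta-v)\left(\frac{p\pi}{q},x\right)=\frac12+\frac2\pi\sum_{j=0}^{q-1}S^{2q}_{2j+1}\left(x-(2j+1)\frac{p\pi}{q}+\frac{p\pi}{q\delta}\right).$$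
   Context: The periodic Riemann problem is the $2\pi$-periodic initial value problem on $(-\pi,\pi)$ with initial datum the unit step $u(0,x)=\frac12(1+\mathrm{sgn}\,x)$. For an evolution equation with odd dispersion relation $\omega(k)$, its solution is given by the Fourier series $$u(t,x)=\frac12+\frac2\pi\sum_{j=0}^\infty\frac{\sin[(2j+1)x-\omega(2j+1)t]}{2j+1}.$$ All series for $u_\delta(t,\cdot)$ and $u_{BO}(t,\cdot)$ are understood as $L^2(-\pi,\pi)$-convergent Fourier series. The linearised Benjamin--Ono dispersion relation is $\omega_{BO}(k)=k^2\,\mathrm{sgn}\,k$. For positive integers $j\le k$, the trigonometric hypergeometric function is $$S^k_j(x)=\sum_{n=0}^\infty\frac{\sin[(nk+j)x]}{nk+j},$$ defined for $x\in\mathbb R$ other than the nodes $x=2\pi l/k$, $l\in\mathbb Z$. *)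

theory Defs
  imports "HOL-Analysis.Analysis"
begin

definition coth :: "real \<Rightarrow> real" where
  "coth x = cosh x / sinh x"

text \<open>Dispersion relations of the linearised Benjamin--Ono and Intermediate Long Wave equations.\<close>

definition omega_BO :: "real \<Rightarrow> real" where
  "omega_BO k = k\<^sup>2 * sgn k"

definition omega_ILW :: "real \<Rightarrow> real \<Rightarrow> real" where
  "omega_ILW \<delta> k = k\<^sup>2 * coth (\<delta> * k) - k / \<delta>"

definition square_integrable :: "(real \<Rightarrow> real) \<Rightarrow> bool" where
  "square_integrable f \<longleftrightarrow>
     f \<in> borel_measurable (lebesgue_on {-pi<..<pi}) \<and>
     integrable (lebesgue_on {-pi<..<pi}) (\<lambda>x. (f x)\<^sup>2)"

text \<open>An element of \<open>L\<^sup>2(-\<pi>,\<pi>)\<close> is represented by a \<open>2\<pi>\<close>-periodic function on the whole line, so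
  that translates in \<open>x\<close> make sense; \<open>L2_sums\<close> thus determines \<open>f\<close> only up to a null set.\<close>

definition periodic :: "(real \<Rightarrow> real) \<Rightarrow> bool" where
  "periodic f \<longleftrightarrow> (\<forall>x. f (x + 2 * pi) = f x)"

definition L2_sums :: "(nat \<Rightarrow> real \<Rightarrow> real) \<Rightarrow> (real \<Rightarrow> real) \<Rightarrow> bool" where
  "L2_sums g f \<longleftrightarrow>
     square_integrable f \<and> (\<forall>n. square_integrable (g n)) \<and>
     (\<lambda>N. LINT x|lebesgue_on {-pi<..<pi}. (f x - (\<Sum>n<N. g n x))\<^sup>2) \<longlonglongrightarrow> 0"

text \<open>\<open>u\<close> is the solution, for times \<open>t \<ge> 0\<close>, of the periodic Riemann problem with dispersion
  relation \<open>\<omega>\<close>: \<open>u t - 1/2\<close> is the \<open>L\<^sup>2\<close>-convergent sum of the Fourier series.\<close>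

definition periodic_riemann_solution :: "(real \<Rightarrow> real) \<Rightarrow> (real \<Rightarrow> real \<Rightarrow> real) \<Rightarrow> bool" where
  "periodic_riemann_solution \<omega> u \<longleftrightarrow>
     (\<forall>t\<ge>0. periodic (u t) \<and>
        L2_sums
          (\<lambda>j x. 2 / pi * (sin (real (2 * j + 1) * x - \<omega> (real (2 * j + 1)) * t) / real (2 * j + 1)))
          (\<lambda>x. u t x - 1 / 2))"

definition fourier_coeff :: "(real \<Rightarrow> real) \<Rightarrow> int \<Rightarrow> complex" where
  "fourier_coeff f k =
     complex_of_real (1 / (2 * pi)) *
       (LINT x|lebesgue_on {-pi<..<pi}. complex_of_real (f x) * exp (- \<i> * of_int k * complex_of_real x))"

definition exponentially_decaying :: "(int \<Rightarrow> complex) \<Rightarrow> bool" where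
  "exponentially_decaying a \<longleftrightarrow>
     (\<exists>C c. c > 0 \<and> (\<forall>k. norm (a k) \<le> C * exp (- c * real_of_int \<bar>k\<bar>)))"

definition C_infinity :: "(real \<Rightarrow> real) \<Rightarrow> bool" where
  "C_infinity f \<longleftrightarrow> (\<forall>n x. (deriv ^^ n) f differentiable (at x))"

text \<open>Trigonometric hypergeometric function \<open>S\<^sup>k\<^sub>j(x)\<close>, for \<open>1 \<le> j \<le> k\<close>. It is meaningful off the nodes
  \<open>x = 2 \<pi> l / k\<close> only, where the (conditionally convergent) series is known to converge.\<close>

definition trig_hyp :: "nat \<Rightarrow> nat \<Rightarrow> real \<Rightarrow> real" where
  "trig_hyp k j x = (\<Sum>n. sin (real (n * k + j) * x) / real (n * k + j))"

end

theory Submission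
  imports Defs "HOL-Real_Asymp.Real_Asymp"
begin

text \<open>
  For \<open>k > 0\<close> the two phases \<open>k x - \<omega>\<^sub>\<delta>(k) t\<close> and \<open>k (x + t/\<delta>) - k\<^sup>2 t\<close> differ only by
  \<open>k\<^sup>2 t (coth (\<delta> k) - 1)\<close>, which is at most \<open>(k t / \<delta>) exp (- \<delta> k)\<close>. By the difference formula for
  sines, \<open>v\<close> is therefore the sum of a series \<open>\<Sum> A\<^sub>k sin (k x + \<phi>\<^sub>k)\<close> with exponentially small amplitudes.
  At time \<open>t = \<pi> p / q\<close>, if \<open>r\<close> is the residue of \<open>k\<close> modulo \<open>2 q\<close>, then \<open>k\<^sup>2 t\<close> and \<open>k r t\<close> agree
  modulo \<open>2 \<pi>\<close>; the terms of the Benjamin--Ono series with residue \<open>r\<close> thus add up to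
  \<open>S\<close> with indices \<open>2 q\<close> and \<open>r\<close>, evaluated at \<open>x - r t\<close>.
  An \<open>L\<^sup>2\<close> limit is identified with a pointwise one along an almost everywhere convergent subsequence
  of partial sums.
\<close>

section \<open>Null sets on the line: translation and periodicity\<close>

lemma AE_lebesgue_iff_negligible:
  fixes P :: "'a::euclidean_space \<Rightarrow> bool"
  shows "(AE x in lebesgue. P x) \<longleftrightarrow> negligible {x. \<not> P x}"
proof
  assume "AE x in lebesgue. P x"
  then obtain N where "N \<in> null_sets lebesgue" "{x. \<not> P x} \<subseteq> N"
    by (auto simp: eventually_ae_filter)
  then show "negligible {x. \<not> P x}"
    using negligible_iff_null_sets negligible_subset by blast
next
  assume "negligible {x. \<not> P x}"
  then show "AE x in lebesgue. P x"
    unfolding negligible_iff_null_sets by (rule AE_I') auto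
qed

lemma negligible_of_countable:
  fixes S :: "'a::euclidean_space set"
  assumes "countable S"
  shows "negligible S"
  using countable_imp_null_set_lborel[OF assms] null_sets_completionI
  by (auto simp: negligible_iff_null_sets)

text \<open>Translates of null sets are null. This serves the Benjamin--Ono solution, which is
  evaluated at the shifted point \<open>x + t / \<delta>\<close>.\<close>

lemma AE_lebesgue_translate:
  fixes P :: "'a::euclidean_space \<Rightarrow> bool"
  assumes "AE x in lebesgue. P x"
  shows "AE x in lebesgue. P (x + c)"
proof -
  have "{x. \<not> P (x + c)} = (+) (- c) ` {x. \<not> P x}"
    by (force simp: image_iff intro: exI[of _ "_ + c"])
  then show ?thesis
    using assms negligible_translation[of "{x. \<not> P x}" "- c"]
    by (simp add: AE_lebesgue_iff_negligible)
qed

lemma periodic_int_shift: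
  fixes f :: "real \<Rightarrow> 'a"
  assumes per: "\<And>x. f (x + T) = f x"
  shows "f (x + of_int k * T) = f x"
proof -
  have nat: "f (y + real n * T) = f y" for y n
  proof (induction n)
    case (Suc n)
    have "f (y + real (Suc n) * T) = f ((y + real n * T) + T)" by (simp add: algebra_simps)
    then show ?case using per Suc by simp
  qed simp
  show ?thesis
  proof (cases "k \<ge> 0")
    case True
    then show ?thesis using nat[of x "nat k"] by simp
  next
    case False
    then show ?thesis using nat[of "x + of_int k * T" "nat (- k)"] by simp
  qed
qed

text \<open>The exceptional set on the line is covered by countably many translates of the one in
  the open period, together with the odd multiples of \<pi>, which those translates miss.\<close>

lemma AE_periodic:
  assumes ae: "AE x in lebesgue_on {-pi<..<pi}. P x"
    and per: "\<And>x. P (x + 2 * pi) = P x"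
  shows "AE x in lebesgue. P x"
proof -
  let ?N = "{x \<in> {-pi<..<pi}. \<not> P x}"
  have "AE x in lebesgue. x \<in> {-pi<..<pi} \<longrightarrow> P x"
    using ae by (subst (asm) AE_restrict_space_iff) auto
  then have N: "negligible ?N"
    by (simp add: AE_lebesgue_iff_negligible conj_comms)
  have "{x. \<not> P x} \<subseteq> (\<Union>k::int. (+) (of_int k * (2 * pi)) ` ?N) \<union> range (\<lambda>k::int. of_int k * (2 * pi) - pi)"
  proof
    fix x assume "x \<in> {x. \<not> P x}"
    then have x: "\<not> P x" by simp
    \<comment> \<open>This \<open>k\<close> is the number of periods to remove in order to bring
      \<open>x\<close> into the half-open interval from -\<pi> (included) to \<pi>.\<close>
    define k where "k = \<lfloor>(x + pi) / (2 * pi)\<rfloor>"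
    define y where "y = x - of_int k * (2 * pi)"
    have "of_int k \<le> (x + pi) / (2 * pi)" "(x + pi) / (2 * pi) < of_int k + 1"
      unfolding k_def by linarith+
    then have y: "-pi \<le> y" "y < pi"
      unfolding y_def by (simp_all add: field_simps)
    have xy: "x = of_int k * (2 * pi) + y" by (simp add: y_def)
    have "\<not> P y"
      using x periodic_int_shift[of P "2 * pi", OF per, of y k] by (simp add: xy add.commute)
    show "x \<in> (\<Union>k::int. (+) (of_int k * (2 * pi)) ` ?N) \<union> range (\<lambda>k::int. of_int k * (2 * pi) - pi)"
    proof (cases "y = - pi")
      case True
      then have "x = of_int k * (2 * pi) - pi" using xy by simp
      then show ?thesis by blast
    next
      case False
      then have "y \<in> ?N" using y \<open>\<not> P y\<close> by auto
      then show ?thesis using xy by blast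
    qed
  qed
  moreover have "negligible (\<Union>k::int. (+) (of_int k * (2 * pi)) ` ?N)"
  proof (rule negligible_countable_Union)
    fix S assume "S \<in> range (\<lambda>k::int. (+) (of_int k * (2 * pi)) ` ?N)"
    then show "negligible S" using negligible_translation[OF N] by blast
  qed simp
  moreover have "negligible (range (\<lambda>k::int. of_int k * (2 * pi) - pi))"
    by (intro negligible_of_countable) auto
  ultimately show ?thesis
    unfolding AE_lebesgue_iff_negligible using negligible_Un negligible_subset by blast
qed

section \<open>From L^2 convergence to almost everywhere convergence\<close>

lemma square_integrable_diff:
  assumes "square_integrable f" "square_integrable g"
  shows "square_integrable (\<lambda>x. f x - g x)"
proof -
  let ?M = "lebesgue_on {-pi<..<pi}"
  have [measurable]: "f \<in> borel_measurable ?M" "g \<in> borel_measurable ?M"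
    and int: "integrable ?M (\<lambda>x. (f x)\<^sup>2)" "integrable ?M (\<lambda>x. (g x)\<^sup>2)"
    using assms by (auto simp: square_integrable_def)
  \<comment> \<open>The right side minus the left side is the square of
    \<open>f x + g x\<close>.\<close>
  have "(f x - g x)\<^sup>2 \<le> 2 * (f x)\<^sup>2 + 2 * (g x)\<^sup>2" for x
    using zero_le_power2[of "f x + g x"] unfolding power2_diff power2_sum by linarith
  then have bound: "norm ((f x - g x)\<^sup>2) \<le> norm (2 * (f x)\<^sup>2 + 2 * (g x)\<^sup>2)" for x
    by (metis abs_ge_self abs_of_nonneg order_trans real_norm_def zero_le_power2)
  have "integrable ?M (\<lambda>x. (f x - g x)\<^sup>2)"
  proof (rule Bochner_Integration.integrable_bound)
    show "integrable ?M (\<lambda>x. 2 * (f x)\<^sup>2 + 2 * (g x)\<^sup>2)" using int by simp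
  qed (measurable, rule AE_I2, rule bound)
  then show ?thesis by (simp add: square_integrable_def)
qed

lemma square_integrable_diff_sum:
  assumes "square_integrable f" "\<And>n. square_integrable (g n)"
  shows "square_integrable (\<lambda>x. f x - (\<Sum>n<N::nat. g n x))"
proof (induction N)
  case 0
  then show ?case using assms by simp
next
  case (Suc N)
  have "square_integrable (\<lambda>x. (f x - (\<Sum>n<N. g n x)) - g N x)"
    by (intro square_integrable_diff Suc assms)
  then show ?case by (simp add: algebra_simps)
qed

text \<open>The squared errors tend to 0 in L^1, so a subsequence of them tends to 0 almost
  everywhere. Starting from a given \<open>r\<close> makes it possible to prescribe the lengths of
  the partial sums, or to refine a subsequence already chosen for another series.\<close>

lemma L2_sums_AE_subseq:
  fixes r :: "nat \<Rightarrow> nat"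
  assumes "L2_sums g f" "strict_mono r"
    and per: "\<And>x. f (x + 2 * pi) = f x" "\<And>n x. g n (x + 2 * pi) = g n x"
  obtains s where "strict_mono s" "AE x in lebesgue. (\<lambda>m. \<Sum>n<r (s m). g n x) \<longlonglongrightarrow> f x"
proof -
  let ?M = "lebesgue_on {-pi<..<pi}"
  define u where "u m x = (f x - (\<Sum>n<r m. g n x))\<^sup>2" for m :: nat and x :: real
  have "integrable ?M (u m)" for m
    using square_integrable_diff_sum[of f g "r m"] assms(1)
    by (auto simp: L2_sums_def square_integrable_def u_def[abs_def])
  moreover have "(\<lambda>m. LINT x|?M. norm (u m x)) \<longlonglongrightarrow> 0"
    using LIMSEQ_subseq_LIMSEQ[OF _ assms(2), of _ 0] assms(1)
    by (fastforce simp: L2_sums_def u_def o_def)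
  ultimately obtain s where s: "strict_mono s" "AE x in ?M. (\<lambda>m. u (s m) x) \<longlonglongrightarrow> 0"
    using tendsto_L1_AE_subseq[of ?M u] by auto
  have "(\<lambda>m. \<Sum>n<r (s m). g n x) \<longlonglongrightarrow> f x" if "(\<lambda>m. u (s m) x) \<longlonglongrightarrow> 0" for x
  proof -
    have "(\<lambda>m. sqrt (u (s m) x)) \<longlonglongrightarrow> sqrt 0"
      using that by (rule tendsto_real_sqrt)
    then have "(\<lambda>m. f x - (\<Sum>n<r (s m). g n x)) \<longlonglongrightarrow> 0"
      by (simp add: u_def tendsto_rabs_zero_iff)
    from tendsto_diff[OF tendsto_const[of "f x"] this] show ?thesis by simp
  qed
  with s(2) have "AE x in ?M. (\<lambda>m. \<Sum>n<r (s m). g n x) \<longlonglongrightarrow> f x"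
    by (auto elim!: eventually_mono)
  then have "AE x in lebesgue. (\<lambda>m. \<Sum>n<r (s m). g n x) \<longlonglongrightarrow> f x"
    by (rule AE_periodic) (simp add: per)
  then show ?thesis using s(1) that by blast
qed

section \<open>Smoothness of sine series with rapidly decreasing amplitudes\<close>

text \<open>Thanks to the free phases the family is closed under differentiation: a derivative
  multiplies each amplitude by its frequency and advances each phase by \<pi>/2. The hypothesis for
  all \<open>m\<close> is inherited by the new amplitudes, so induction on the order
  applies.\<close>

lemma C_infinity_sine_series:
  fixes A \<nu> \<phi> :: "nat \<Rightarrow> real"
  assumes "\<And>m. summable (\<lambda>n. \<bar>A n * \<nu> n ^ m\<bar>)"
  shows "C_infinity (\<lambda>x. \<Sum>n. A n * sin (\<nu> n * x + \<phi> n))"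
proof -
  define F where "F A \<phi> x = (\<Sum>n. A n * sin (\<nu> n * x + \<phi> n))" for A \<phi> :: "nat \<Rightarrow> real" and x
  have deriv_F: "(F A \<phi> has_field_derivative F (\<lambda>n. A n * \<nu> n) (\<lambda>n. \<phi> n + pi / 2) x) (at x)"
    if A: "\<And>m. summable (\<lambda>n. \<bar>A n * \<nu> n ^ m\<bar>)" for A \<phi> :: "nat \<Rightarrow> real" and x
    unfolding F_def
  \<comment> \<open>Termwise differentiation rests on uniform convergence of the differentiated
    series and convergence of the original one at a single point, here 0.\<close>
  proof (rule has_field_derivative_series'(2)[of UNIV _ _ 0])
    show "((\<lambda>x. A n * sin (\<nu> n * x + \<phi> n)) has_field_derivative
        A n * \<nu> n * sin (\<nu> n * x + (\<phi> n + pi / 2))) (at x)" for n x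
      by (auto intro!: derivative_eq_intros simp: sin_add cos_add distrib_left right_diff_distrib)
    show "uniformly_convergent_on UNIV (\<lambda>n x. \<Sum>i<n. A i * \<nu> i * sin (\<nu> i * x + (\<phi> i + pi / 2)))"
      by (rule Weierstrass_m_test'[where M = "\<lambda>n. \<bar>A n * \<nu> n\<bar>"])
        (use A[of 1] in \<open>auto simp: abs_mult intro!: mult_left_le\<close>)
    show "summable (\<lambda>n. A n * sin (\<nu> n * 0 + \<phi> n))"
      by (rule summable_comparison_test'[of "\<lambda>n. \<bar>A n\<bar>"])
        (use A[of 0] in \<open>auto simp: abs_mult intro!: mult_left_le\<close>)
  qed auto
  have "(deriv ^^ n) (F A \<phi>) differentiable (at x)"
    if "\<And>m. summable (\<lambda>n. \<bar>A n * \<nu> n ^ m\<bar>)" for n A \<phi> x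
    using that
  proof (induction n arbitrary: A \<phi>)
    case 0
    then show ?case
      using deriv_F[of A \<phi> x] real_differentiable_def by auto
  next
    case (Suc n)
    have "deriv (F A \<phi>) = F (\<lambda>n. A n * \<nu> n) (\<lambda>n. \<phi> n + pi / 2)"
      using deriv_F[OF Suc.prems] by (auto intro!: DERIV_imp_deriv)
    moreover have "summable (\<lambda>n. \<bar>A n * \<nu> n * \<nu> n ^ m\<bar>)" for m
      using Suc.prems[of "Suc m"] by (simp add: mult.assoc)
    ultimately show ?case
      using Suc.IH by (simp add: funpow_Suc_right del: funpow.simps)
  qed
  then show ?thesis
    using assms unfolding C_infinity_def F_def[abs_def] by blast
qed

section \<open>Convergence of the trigonometric hypergeometric series\<close>

lemma summable_decreasing_times_unit_power:
  fixes a :: "nat \<Rightarrow> real" and z :: complex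
  assumes "decseq a" "a \<longlonglongrightarrow> 0" "norm z = 1" "z \<noteq> 1"
  shows "summable (\<lambda>n. of_real (a n) * z ^ n)"
proof -
  \<comment> \<open>Summation by parts turns the series into one dominated by a telescoping series.\<close>
  have abel: "(1 - z) * (\<Sum>n<N. of_real (a n) * z ^ n) =
      of_real (a 0) - of_real (a N) * z ^ N - (\<Sum>n<N. of_real (a n - a (Suc n)) * z ^ Suc n)" for N
    by (induction N) (simp_all add: algebra_simps)
  have "(\<lambda>N. of_real (a N) * z ^ N) \<longlonglongrightarrow> 0"
    by (rule Lim_null_comparison[OF _ assms(2)[THEN tendsto_rabs_zero]])
      (simp add: norm_mult norm_power assms(3))
  moreover have "summable (\<lambda>n. of_real (a n - a (Suc n)) * z ^ Suc n)"
  proof (rule summable_comparison_test'[of "\<lambda>n. a n - a (Suc n)"])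
    show "summable (\<lambda>n. a n - a (Suc n))"
      using telescope_summable'[OF assms(2)] by simp
    show "norm (of_real (a n - a (Suc n)) * z ^ Suc n) \<le> a n - a (Suc n)" for n
      using decseq_SucD[OF assms(1), of n] by (simp only: norm_mult norm_power assms(3) norm_of_real) simp
  qed
  ultimately have "convergent (\<lambda>N. (1 - z) * (\<Sum>n<N. of_real (a n) * z ^ n))"
    unfolding abel summable_iff_convergent
    by (intro convergent_diff convergent_const) (auto intro: convergentI)
  then show ?thesis
    using assms(4) by (simp add: summable_iff_convergent convergent_mult_const_iff)
qed

text \<open>The series is the imaginary part of \<open>cis (j * x)\<close> times a power series in z
  = \<open>cis (k * x)\<close> with coefficients decreasing to 0. The excluded nodes are exactly the
  points where z = 1.\<close>

lemma summable_trig_hyp: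
  fixes k j :: nat
  assumes "k > 0" "j > 0" "\<And>l::int. x \<noteq> 2 * pi * of_int l / real k"
  shows "summable (\<lambda>n. sin (real (n * k + j) * x) / real (n * k + j))"
proof -
  let ?a = "\<lambda>n. 1 / real (n * k + j)"
  have "decseq ?a"
    using assms by (auto simp: decseq_def intro!: divide_left_mono mult_pos_pos simp flip: of_nat_mult of_nat_add)
  moreover have "?a \<longlonglongrightarrow> 0"
    using assms by real_asymp
  moreover have "cis (real k * x) \<noteq> 1"
  proof
    assume "cis (real k * x) = 1"
    then have "cos (real k * x) = 1" by (simp add: complex_eq_iff)
    then obtain l :: int where "real k * x = of_int l * 2 * pi"
      using cos_one_2pi_int by auto
    then have "x = 2 * pi * of_int l / real k" using assms by (simp add: field_simps)
    then show False using assms(3) by blast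
  qed
  ultimately have "summable (\<lambda>n. of_real (?a n) * cis (real k * x) ^ n)"
    by (intro summable_decreasing_times_unit_power) auto
  then have "summable (\<lambda>n. cis (real j * x) * (of_real (?a n) * cis (real k * x) ^ n))"
    by (rule summable_mult)
  then have "summable (\<lambda>n. Im (cis (real j * x) * (of_real (?a n) * cis (real k * x) ^ n)))"
    by (rule summable_Im)
  moreover have "cis (real j * x) * (of_real (?a n) * cis (real k * x) ^ n) =
      of_real (?a n) * cis (real (n * k + j) * x)" for n
  proof -
    have "cis (real (n * k + j) * x) = cis (real j * x) * cis (real k * x) ^ n"
      unfolding Complex.DeMoivre cis_mult by (simp add: algebra_simps)
    then show ?thesis by (simp only: mult.left_commute)
  qed
  ultimately have "summable (\<lambda>n. Im (of_real (?a n) * cis (real (n * k + j) * x)))"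
    by (simp only:)
  then show ?thesis by simp
qed

section \<open>Estimate for the hyperbolic cotangent\<close>

text \<open>\<open>coth x - 1\<close> equals \<open>exp (- x) / sinh x\<close>, and
  \<open>sinh x \<ge> x\<close> because \<open>sinh y - y\<close> has derivative
  \<open>cosh y - 1 \<ge> 0\<close>.\<close>

lemma coth_minus_one_bounds:
  assumes "x > 0"
  shows "0 \<le> coth x - 1" "coth x - 1 \<le> exp (- x) / x"
proof -
  have "sinh 0 - 0 \<le> sinh x - x"
  proof (rule DERIV_nonneg_imp_nondecreasing[where f = "\<lambda>y. sinh y - y"])
    fix y :: real
    have "((\<lambda>y. sinh y - y) has_real_derivative cosh y - 1) (at y)"
      by (auto intro!: derivative_eq_intros)
    then show "\<exists>D. ((\<lambda>y. sinh y - y) has_real_derivative D) (at y) \<and> 0 \<le> D"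
      using cosh_real_ge_1[of y] by force
  qed (use assms in simp)
  then have sinh: "sinh x \<ge> x" "sinh x > 0"
    using assms by auto
  have "coth x - 1 = exp (- x) / sinh x"
    using sinh by (simp add: coth_def field_simps cosh_minus_sinh flip: cosh_minus_sinh)
  then show "0 \<le> coth x - 1" "coth x - 1 \<le> exp (- x) / x"
    using sinh assms by (auto intro!: divide_left_mono)
qed

section \<open>Fourier coefficients of continuous functions\<close>

lemma lebesgue_on_continuous_integrable:
  fixes f :: "real \<Rightarrow> 'b::euclidean_space"
  assumes "continuous_on UNIV f"
  shows "integrable (lebesgue_on {a<..<b}) f"
proof -
  have "integrable (lebesgue_on {a..b}) f"
    using assms continuous_on_subset by (blast intro: continuous_imp_integrable_real)
  then have "set_integrable lebesgue {a..b} f"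
    by (simp add: integrable_restrict_space set_integrable_def)
  then have "set_integrable lebesgue {a<..<b} f"
    by (rule set_integrable_subset) auto
  then show ?thesis
    by (simp add: integrable_restrict_space set_integrable_def)
qed

lemma integral_exp_int:
  assumes "k \<noteq> 0"
  shows "integral\<^sup>L (lebesgue_on {-pi<..<pi}) (\<lambda>x. exp (\<i> * of_int k * complex_of_real x)) = 0"
proof -
  let ?h = "\<lambda>x. exp (\<i> * of_int k * complex_of_real x)"
  let ?H = "\<lambda>x. exp (\<i> * of_int k * complex_of_real x) / (\<i> * of_int k)"
  have "integral\<^sup>L (lebesgue_on {-pi<..<pi}) ?h = integral {-pi<..<pi} ?h"
    by (intro lebesgue_integral_eq_integral lebesgue_on_continuous_integrable continuous_intros) auto
  also have "\<dots> = integral {-pi..pi} ?h"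
    by (simp add: integral_open_interval_real)
  also have "(?h has_integral (?H pi - ?H (-pi))) {-pi..pi}"
  proof (rule fundamental_theorem_of_calculus)
    fix x assume "x \<in> {-pi..pi}"
    have "((\<lambda>z. exp (\<i> * of_int k * z) / (\<i> * of_int k)) has_field_derivative ?h x) (at (complex_of_real x))"
      using assms by (auto intro!: derivative_eq_intros)
    then show "(?H has_vector_derivative ?h x) (at x within {-pi..pi})"
      using field_vector_diff_chain_within has_vector_derivative_at_within has_vector_derivative_real_field by blast
  qed simp
  then have "integral {-pi..pi} ?h = ?H pi - ?H (-pi)"
    by (rule integral_unique)
  \<comment> \<open>The two exponents differ by 2 \<pi> i k, so the antiderivative takes the same
    value at both endpoints.\<close>
  also have "exp (\<i> * of_int k * complex_of_real pi) = exp (\<i> * of_int k * complex_of_real (- pi))"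
    by (rule exp_eq[THEN iffD2]) (auto intro!: exI[of _ k] simp: algebra_simps)
  finally show ?thesis by simp
qed

text \<open>Euler's formula splits the sine into exponentials of frequencies m and -m, both
  different from k, and each is orthogonal to the k-th exponential.\<close>

lemma fourier_coeff_sin_eq_0:
  assumes "\<bar>k\<bar> \<noteq> int m"
  shows "fourier_coeff (\<lambda>x. A * sin (real m * x + \<phi>)) k = 0"
proof -
  let ?M = "lebesgue_on {-pi<..<pi}"
  let ?e = "\<lambda>l x. exp (\<i> * of_int l * complex_of_real x)"
  have "complex_of_real (A * sin (real m * x + \<phi>)) * exp (- \<i> * of_int k * complex_of_real x) =
      of_real A / (2 * \<i>) * exp (\<i> * of_real \<phi>) * ?e (int m - k) x -
      of_real A / (2 * \<i>) * exp (- \<i> * of_real \<phi>) * ?e (- int m - k) x" for x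
  proof -
    let ?z = "complex_of_real (real m * x + \<phi>)" and ?K = "exp (- \<i> * of_int k * complex_of_real x)"
    have "exp (\<i> * ?z) * ?K = exp (\<i> * of_real \<phi>) * ?e (int m - k) x"
      "exp (- (\<i> * ?z)) * ?K = exp (- \<i> * of_real \<phi>) * ?e (- int m - k) x"
      by (simp_all add: algebra_simps flip: exp_add)
    moreover have "complex_of_real (A * sin (real m * x + \<phi>)) * ?K =
        of_real A / (2 * \<i>) * (exp (\<i> * ?z) * ?K) - of_real A / (2 * \<i>) * (exp (- (\<i> * ?z)) * ?K)"
      by (simp only: of_real_mult sin_of_real[symmetric] sin_exp_eq) (simp add: field_simps)
    ultimately show ?thesis by (simp only: mult.assoc)
  qed
  moreover have "integrable ?M (?e l)" for l
    by (intro lebesgue_on_continuous_integrable continuous_intros)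
  moreover have "int m - k \<noteq> 0" "- int m - k \<noteq> 0"
    using assms by auto
  ultimately show ?thesis
    by (simp add: fourier_coeff_def integral_exp_int del: of_int_diff)
qed

lemma integrable_fourier_integrand:
  assumes "continuous_on UNIV f"
  shows "integrable (lebesgue_on {-pi<..<pi})
    (\<lambda>x. complex_of_real (f x) * exp (- \<i> * of_int k * complex_of_real x))"
  by (intro lebesgue_on_continuous_integrable continuous_intros assms)

lemma fourier_coeff_add:
  assumes "continuous_on UNIV f" "continuous_on UNIV g"
  shows "fourier_coeff (\<lambda>x. f x + g x) k = fourier_coeff f k + fourier_coeff g k"
  using assms[THEN integrable_fourier_integrand, of k]
  by (simp add: fourier_coeff_def algebra_simps)

lemma norm_fourier_coeff_le:
  assumes "continuous_on UNIV f" "\<And>x. \<bar>f x\<bar> \<le> B"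
  shows "norm (fourier_coeff f k) \<le> B"
proof -
  let ?M = "lebesgue_on {-pi<..<pi}"
  let ?h = "\<lambda>x. complex_of_real (f x) * exp (- \<i> * of_int k * complex_of_real x)"
  have "norm (integral\<^sup>L ?M ?h) \<le> (LINT x|?M. B)"
  proof (rule Bochner_Integration.integral_norm_bound_integral)
    show "norm (?h x) \<le> B" for x
      using assms(2)[of x] by (simp add: norm_mult)
  qed (intro integrable_fourier_integrand assms(1) lebesgue_on_continuous_integrable continuous_on_const)+
  also have "\<dots> = 2 * pi * B"
    by (simp add: measure_restrict_space)
  finally have "1 / (2 * pi) * norm (integral\<^sup>L ?M ?h) \<le> 1 / (2 * pi) * (2 * pi * B)"
    by (rule mult_left_mono) simp
  then show ?thesis
    unfolding fourier_coeff_def norm_mult norm_of_real by simp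
qed

section \<open>Sine series with exponentially small amplitudes\<close>

text \<open>Half of the exponential decay absorbs the power: with z = c y / 2, the single term z^m /
  m! of the exponential series is at most exp z.\<close>

lemma power_mult_exp_minus_le:
  fixes y :: real
  assumes "y \<ge> 0" "c > 0"
  shows "y ^ m * exp (- c * y) \<le> fact m * (2 / c) ^ m * exp (- (c / 2) * y)"
proof -
  let ?z = "c / 2 * y"
  have z: "z ^ m \<le> fact m * exp z" if "z \<ge> 0" for z :: real
  proof -
    have exp: "(\<lambda>n. z ^ n /\<^sub>R fact n) sums exp z"
      by (rule exp_converges)
    have "(\<Sum>n\<in>{m}. z ^ n /\<^sub>R fact n) \<le> exp z"
      unfolding sums_unique[OF exp]
      by (rule sum_le_suminf[OF sums_summable[OF exp]]) (use that in auto)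
    then show ?thesis
      by (simp add: field_simps)
  qed
  have y: "y ^ m = (2 / c) ^ m * ?z ^ m"
    unfolding power_mult_distrib[symmetric] using assms by simp
  have "y ^ m * exp (- c * y) \<le> (2 / c) ^ m * (fact m * exp ?z) * exp (- c * y)"
    unfolding y using assms z[of ?z] by (intro mult_right_mono mult_left_mono) auto
  also have "\<dots> = fact m * (2 / c) ^ m * (exp ?z * exp (- c * y))"
    by (simp only: ac_simps)
  also have "exp ?z * exp (- c * y) = exp (- (c / 2) * y)"
    unfolding exp_add[symmetric] by simp
  finally show ?thesis .
qed

lemma exp_odd_eq: "exp (- c * real (2 * n + 1)) = exp (- c) * exp (- 2 * c) ^ n"
  unfolding exp_of_nat_mult[symmetric] exp_add[symmetric] by (simp add: algebra_simps)

lemma summable_exp_odd: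
  assumes "c > 0"
  shows "summable (\<lambda>n. exp (- c * real (2 * n + 1)))"
  unfolding exp_odd_eq using assms by (intro summable_mult summable_geometric) auto

text \<open>Supplies the hypothesis of \<open>C_infinity_sine_series\<close> for the odd
  frequencies, by comparison with a geometric series of half the decay rate.\<close>

lemma summable_exp_decay_power:
  assumes "c > 0" "\<And>n. \<bar>A n\<bar> \<le> B * exp (- c * real (2 * n + 1))"
  shows "summable (\<lambda>n. \<bar>A n * real (2 * n + 1) ^ m\<bar>)"
proof (rule summable_comparison_test')
  show "summable (\<lambda>n. \<bar>B\<bar> * (fact m * (2 / c) ^ m) * exp (- (c / 2) * real (2 * n + 1)))"
    using assms(1) by (intro summable_mult summable_exp_odd) simp
  show "norm \<bar>A n * real (2 * n + 1) ^ m\<bar>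
      \<le> \<bar>B\<bar> * (fact m * (2 / c) ^ m) * exp (- (c / 2) * real (2 * n + 1))" for n
  proof -
    let ?y = "real (2 * n + 1)"
    have "\<bar>A n\<bar> \<le> \<bar>B\<bar> * exp (- c * ?y)"
      using assms(2)[of n] abs_ge_self[of B] by (meson exp_ge_zero mult_right_mono order_trans)
    then have "\<bar>A n\<bar> * ?y ^ m \<le> \<bar>B\<bar> * exp (- c * ?y) * ?y ^ m"
      by (rule mult_right_mono) simp
    also have "\<dots> = \<bar>B\<bar> * (?y ^ m * exp (- c * ?y))"
      by (simp only: ac_simps)
    also have "\<dots> \<le> \<bar>B\<bar> * (fact m * (2 / c) ^ m * exp (- (c / 2) * ?y))"
      using assms(1) by (intro mult_left_mono power_mult_exp_minus_le) auto
    finally show ?thesis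
      by (simp only: abs_mult mult.assoc real_norm_def abs_abs power_abs abs_of_nat)
  qed
qed

lemma continuous_on_C_infinity:
  assumes "C_infinity f"
  shows "continuous_on UNIV f"
  using assms[unfolded C_infinity_def, rule_format, of 0]
  by (auto intro!: continuous_at_imp_continuous_on differentiable_imp_continuous_within)

lemma exponentially_decaying_fourier_sine_series:
  fixes A \<phi> :: "nat \<Rightarrow> real"
  assumes c: "c > 0" and A: "\<And>n. \<bar>A n\<bar> \<le> B * exp (- c * real (2 * n + 1))"
  shows "exponentially_decaying (fourier_coeff (\<lambda>x. \<Sum>n. A n * sin (real (2 * n + 1) * x + \<phi> n)))"
proof -
  define g where "g n x = A n * sin (real (2 * n + 1) * x + \<phi> n)" for n :: nat and x :: real
  \<comment> \<open>The denominator comes from summing the tail as a geometric series: consecutive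
    odd frequencies differ by 2, so its ratio is \<open>exp (- 2 * c)\<close>.\<close>
  define C where "C = \<bar>B\<bar> / (1 - exp (- 2 * c))"
  have gA: "\<bar>g n x\<bar> \<le> \<bar>A n\<bar>" for n x
    by (auto simp: g_def abs_mult intro!: mult_left_le)
  have sA: "summable (\<lambda>n. \<bar>A n\<bar>)"
    using summable_exp_decay_power[OF assms, of 0] by simp
  have sg: "summable (\<lambda>n. g n x)" for x
    by (rule summable_comparison_test'[OF sA]) (simp add: gA)
  have "C_infinity (\<lambda>x. \<Sum>n. g n x)"
    unfolding g_def by (intro C_infinity_sine_series summable_exp_decay_power[OF assms])
  then have cont: "continuous_on UNIV (\<lambda>x. \<Sum>n. g n x)"
    by (rule continuous_on_C_infinity)
  have cont_g: "continuous_on UNIV (g n)" for n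
    unfolding g_def[abs_def] by (intro continuous_intros)
  have cont_sum: "continuous_on UNIV (\<lambda>x. \<Sum>n<M. g n x)" for M
    by (intro continuous_on_sum cont_g)
  have "norm (fourier_coeff (\<lambda>x. \<Sum>n. g n x) k) \<le> C * exp (- c * of_int \<bar>k\<bar>)" for k
  proof -
    \<comment> \<open>The first \<open>N\<close> terms have frequencies below \<open>\<bar>k\<bar>\<close> and do not contribute to the \<open>k\<close>-th coefficient,
      so that the coefficient is bounded by the supremum of the tail.\<close>
    define N where "N = nat \<bar>k\<bar> div 2"
    define R where "R x = (\<Sum>n. g n x) - (\<Sum>n<N. g n x)" for x
    have cont_R: "continuous_on UNIV R"
      unfolding R_def[abs_def] by (intro continuous_on_diff cont cont_sum)
    have "fourier_coeff (\<lambda>x. \<Sum>n<M. g n x) k = 0" if "M \<le> N" for M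
      using that
    proof (induction M)
      case (Suc M)
      have "2 * M + 1 < nat \<bar>k\<bar>"
        using Suc.prems unfolding N_def by linarith
      then have "fourier_coeff (g M) k = 0"
        unfolding g_def[abs_def] by (intro fourier_coeff_sin_eq_0) linarith
      then show ?case
        using Suc.IH Suc.prems fourier_coeff_add[OF cont_sum[of M] cont_g[of M], of k] by simp
    qed (simp add: fourier_coeff_def)
    then have "fourier_coeff (\<lambda>x. \<Sum>n. g n x) k = fourier_coeff R k"
      using fourier_coeff_add[OF cont_sum[of N] cont_R, of k] by (simp add: R_def)
    also have "norm \<dots> \<le> C * exp (- c * real (2 * N + 1))"
    proof (rule norm_fourier_coeff_le[OF cont_R])
      let ?E = "\<bar>B\<bar> * exp (- c * real (2 * N + 1))"
      have bound: "\<bar>g (n + N) x\<bar> \<le> ?E * exp (- 2 * c) ^ n" for n x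
      proof -
        have "\<bar>g (n + N) x\<bar> \<le> B * exp (- c * real (2 * (n + N) + 1))"
          using gA A by (rule order_trans)
        also have "\<dots> \<le> \<bar>B\<bar> * exp (- c * real (2 * (n + N) + 1))"
          by (intro mult_right_mono) auto
        also have "\<dots> = ?E * exp (- 2 * c) ^ n"
          unfolding exp_odd_eq power_add by (simp only: ac_simps)
        finally show ?thesis .
      qed
      have geo: "(\<lambda>n. ?E * exp (- 2 * c) ^ n) sums (?E * (1 / (1 - exp (- 2 * c))))"
        using c by (intro sums_mult geometric_sums) auto
      show "\<bar>R x\<bar> \<le> C * exp (- c * real (2 * N + 1))" for x
      proof -
        have "R x = (\<Sum>n. g (n + N) x)"
          using suminf_split_initial_segment[OF sg, of x N] by (simp add: R_def)
        also have "norm \<dots> \<le> (\<Sum>n. ?E * exp (- 2 * c) ^ n)"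
          by (rule norm_suminf_le) (use bound sums_summable[OF geo] in auto)
        also have "\<dots> = C * exp (- c * real (2 * N + 1))"
          using sums_unique[OF geo] by (simp add: C_def)
        finally show ?thesis by simp
      qed
    qed
    also have "\<dots> \<le> C * exp (- c * of_int \<bar>k\<bar>)"
    proof (rule mult_left_mono)
      \<comment> \<open>The first frequency left in the tail is already at least
        \<open>\<bar>k\<bar>\<close>; for odd \<open>k\<close> the two are equal.\<close>
      have "of_int \<bar>k\<bar> \<le> real (2 * N + 1)" unfolding N_def by linarith
      then show "exp (- c * real (2 * N + 1)) \<le> exp (- c * of_int \<bar>k\<bar>)"
        using c by simp
      show "0 \<le> C" using c by (simp add: C_def)
    qed
    finally show ?thesis .
  qed
  then show ?thesis
    using c unfolding exponentially_decaying_def g_def by blast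
qed

text \<open>Transfers the decay from the smooth sum of the sine series to \<open>v t\<close>, which
  agrees with it only almost everywhere.\<close>

lemma fourier_coeff_cong_AE:
  assumes ae: "AE x in lebesgue. f x = g x" and g: "continuous_on UNIV g"
  shows "fourier_coeff f = fourier_coeff g"
proof -
  let ?M = "lebesgue_on {-pi<..<pi}"
  have "g \<in> borel_measurable lebesgue"
    using g continuous_imp_measurable_on_sets_lebesgue[of UNIV g] by simp
  \<comment> \<open>Measurability passes from \<open>g\<close> to \<open>f\<close> because Lebesgue
    measure is complete.\<close>
  moreover from this have "f \<in> borel_measurable lebesgue"
    by (rule borel_measurable_AE) (use ae in \<open>simp add: eq_commute\<close>)
  ultimately have [measurable]: "g \<in> borel_measurable ?M" "f \<in> borel_measurable ?M"
    by (auto intro: measurable_restrict_space1)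
  have [measurable]: "(\<lambda>x. exp (- \<i> * of_int k * complex_of_real x)) \<in> borel_measurable ?M" for k
    by (intro continuous_imp_measurable_on_sets_lebesgue continuous_intros) auto
  have "AE x in ?M. f x = g x"
    using ae by (subst AE_restrict_space_iff) (auto elim: eventually_mono)
  then have "AE x in ?M. complex_of_real (f x) * exp (- \<i> * of_int k * complex_of_real x) =
      complex_of_real (g x) * exp (- \<i> * of_int k * complex_of_real x)" for k
    by (auto elim: eventually_mono)
  then have "(LINT x|?M. complex_of_real (f x) * exp (- \<i> * of_int k * complex_of_real x)) =
      (LINT x|?M. complex_of_real (g x) * exp (- \<i> * of_int k * complex_of_real x))" for k
    by (intro integral_cong_AE) measurable
  then show ?thesis
    by (simp add: fourier_coeff_def fun_eq_iff)
qed

section \<open>Terms of the Riemann series for the two dispersion relations\<close>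

text \<open>The summand of \<open>periodic_riemann_solution\<close>, with the arguments ordered so
  that \<open>riemann_term \<omega> t\<close> is the sequence passed to
  \<open>L2_sums\<close>.\<close>

definition riemann_term :: "(real \<Rightarrow> real) \<Rightarrow> real \<Rightarrow> nat \<Rightarrow> real \<Rightarrow> real" where
  "riemann_term \<omega> t j x = 2 / pi * (sin (real (2 * j + 1) * x - \<omega> (real (2 * j + 1)) * t) / real (2 * j + 1))"

lemma sin_plus_2pi_nat: "sin (y + 2 * pi * real n) = sin y"
proof -
  have "2 * pi * real n = 2 * real n * pi" by simp
  then show ?thesis
    by (simp only: sin_add sin_2npi cos_2npi mult_1_right mult_zero_right add_0_right)
qed

lemma riemann_term_periodic: "riemann_term \<omega> t j (x + 2 * pi) = riemann_term \<omega> t j x"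
proof -
  have "real (2 * j + 1) * (x + 2 * pi) - \<omega> (real (2 * j + 1)) * t =
      (real (2 * j + 1) * x - \<omega> (real (2 * j + 1)) * t) + 2 * pi * real (2 * j + 1)"
    by (simp only: distrib_left) (simp only: algebra_simps)
  then show ?thesis
    by (simp only: riemann_term_def sin_plus_2pi_nat)
qed

lemma periodic_riemann_solution_AE_subseq:
  fixes r :: "nat \<Rightarrow> nat"
  assumes "periodic_riemann_solution \<omega> u" "t \<ge> 0" "strict_mono r"
  obtains s where "strict_mono s"
    "AE x in lebesgue. (\<lambda>m. \<Sum>n<r (s m). riemann_term \<omega> t n x) \<longlonglongrightarrow> u t x - 1 / 2"
proof (rule L2_sums_AE_subseq[of "riemann_term \<omega> t" "\<lambda>x. u t x - 1 / 2", OF _ assms(3)])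
  show "L2_sums (riemann_term \<omega> t) (\<lambda>x. u t x - 1 / 2)"
    using assms(1,2) unfolding periodic_riemann_solution_def riemann_term_def[abs_def] by blast
  show "u t (x + 2 * pi) - 1 / 2 = u t x - 1 / 2" for x
    using assms(1,2) by (simp add: periodic_riemann_solution_def periodic_def)
qed (rule riemann_term_periodic, rule that)

text \<open>The shift by \<open>t / \<delta>\<close> cancels the term \<open>- k / \<delta>\<close>
  of \<open>omega_ILW\<close>. What remains is the phase lag \<open>a n\<close>, exponentially small
  by the bound on \<open>coth\<close>.\<close>

lemma riemann_term_ILW_diff_BO:
  assumes "\<delta> > 0" "t \<ge> 0"
  obtains A B \<phi> where
    "\<And>n. \<bar>A n\<bar> \<le> B * exp (- \<delta> * real (2 * n + 1))"
    "\<And>n x. riemann_term (omega_ILW \<delta>) t n x - riemann_term omega_BO t n (x + t / \<delta>)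
      = A n * sin (real (2 * n + 1) * x + \<phi> n)"
proof -
  define k :: "nat \<Rightarrow> real" where "k n = real (2 * n + 1)" for n
  have k: "k n > 0" for n by (simp add: k_def)
  define a where "a n = (k n)\<^sup>2 * t * (coth (\<delta> * k n) - 1)" for n
  \<comment> \<open>\<open>A\<close> and \<open>\<phi>\<close> are read off from sin(\<theta> - a) -
    sin \<theta> = -2 sin(a/2) cos(\<theta> - a/2); the summand \<pi>/2 in the phase turns the
    cosine into a sine.\<close>
  define A where "A n = - 4 / (pi * k n) * sin (a n / 2)" for n
  define \<phi> where "\<phi> n = k n * (t / \<delta>) - (k n)\<^sup>2 * t - a n / 2 + pi / 2" for n
  have "\<bar>A n\<bar> \<le> 2 * t / (pi * \<delta>) * exp (- \<delta> * k n)" for n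
  proof -
    have "\<delta> * k n > 0" using assms k by simp
    note b = coth_minus_one_bounds[OF this]
    have a0: "0 \<le> a n" unfolding a_def using b assms by simp
    have "a n \<le> (k n)\<^sup>2 * t * (exp (- (\<delta> * k n)) / (\<delta> * k n))"
      unfolding a_def using b assms by (intro mult_left_mono) auto
    also have "\<dots> = k n * t / \<delta> * exp (- \<delta> * k n)"
      using k[of n] by (simp add: power2_eq_square)
    finally have a: "a n \<le> k n * t / \<delta> * exp (- \<delta> * k n)" .
    have "\<bar>A n\<bar> = 4 / (pi * k n) * \<bar>sin (a n / 2)\<bar>"
      using k[of n] by (simp add: A_def abs_mult)
    also have "\<dots> \<le> 4 / (pi * k n) * (a n / 2)"
      using k[of n] a0 abs_sin_x_le_abs_x[of "a n / 2"] by (intro mult_left_mono) auto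
    \<comment> \<open>The factor \<open>k n\<close> in the bound for \<open>a n\<close> cancels the
      denominator of the amplitude, which leaves a constant independent of \<open>n\<close>.\<close>
    also have "\<dots> \<le> 4 / (pi * k n) * (k n * t / \<delta> * exp (- \<delta> * k n) / 2)"
      using k[of n] a by (intro mult_left_mono divide_right_mono) auto
    also have "\<dots> = 2 * t / (pi * \<delta>) * exp (- \<delta> * k n)"
      using k[of n] by simp
    finally show ?thesis .
  qed
  moreover have "riemann_term (omega_ILW \<delta>) t n x - riemann_term omega_BO t n (x + t / \<delta>)
      = A n * sin (k n * x + \<phi> n)" for n x
  proof -
    define \<theta> where "\<theta> = k n * (x + t / \<delta>) - (k n)\<^sup>2 * t"
    have ILW: "k n * x - omega_ILW \<delta> (k n) * t = \<theta> - a n"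
      by (simp add: \<theta>_def omega_ILW_def a_def algebra_simps)
    have BO: "k n * (x + t / \<delta>) - omega_BO (k n) * t = \<theta>"
      using k[of n] by (simp add: \<theta>_def omega_BO_def)
    have "k n * x + \<phi> n = (\<theta> - a n / 2) + pi / 2"
      by (simp add: \<phi>_def \<theta>_def distrib_left)
    then have "sin (k n * x + \<phi> n) = cos (\<theta> - a n / 2)"
      by (simp add: sin_add)
    moreover have "sin (\<theta> - a n) - sin \<theta> = 2 * sin (- (a n / 2)) * cos (\<theta> - a n / 2)"
    proof -
      have "(\<theta> - a n - \<theta>) / 2 = - (a n / 2)" "(\<theta> - a n + \<theta>) / 2 = \<theta> - a n / 2"
        by (simp_all add: field_simps)
      then show ?thesis by (simp only: sin_diff_sin)
    qed
    ultimately have diff: "sin (\<theta> - a n) - sin \<theta> = - 2 * sin (a n / 2) * sin (k n * x + \<phi> n)"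
      by simp
    have "riemann_term (omega_ILW \<delta>) t n x - riemann_term omega_BO t n (x + t / \<delta>)
        = 2 / pi * ((sin (\<theta> - a n) - sin \<theta>) / k n)"
      unfolding riemann_term_def k_def[symmetric] ILW BO
      by (simp only: right_diff_distrib diff_divide_distrib)
    also have "\<dots> = A n * sin (k n * x + \<phi> n)"
      unfolding diff A_def by simp
    finally show ?thesis .
  qed
  ultimately show ?thesis
    by (intro that[of A "2 * t / (pi * \<delta>)" \<phi>]) (simp_all only: k_def)
qed

section \<open>The Benjamin--Ono solution at rational times\<close>

text \<open>Partial sums of length \<open>M * q\<close> contain exactly \<open>M\<close> terms from
  each odd residue class modulo \<open>2 * q\<close>, so they regroup into \<open>q\<close> partial
  sums of equal length.\<close>

lemma sum_riemann_term_BO_rational: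
  fixes p q M :: nat
  assumes "q > 0"
  shows "(\<Sum>n<M * q. riemann_term omega_BO (real p * pi / real q) n y) =
    2 / pi * (\<Sum>j<q. \<Sum>n<M. sin (real (n * (2 * q) + (2 * j + 1)) * (y - real (2 * j + 1) * (real p * pi / real q)))
      / real (n * (2 * q) + (2 * j + 1)))"
proof -
  let ?t = "real p * pi / real q"
  let ?f = "\<lambda>n. riemann_term omega_BO ?t n y"
  have rterm: "?f (n * q + j) = 2 / pi * (sin (real (n * (2 * q) + (2 * j + 1)) * (y - real (2 * j + 1) * ?t))
      / real (n * (2 * q) + (2 * j + 1)))" for n j
  proof -
    define k where "k = n * (2 * q) + (2 * j + 1)"
    have k: "2 * (n * q + j) + 1 = k" by (simp add: k_def)
    \<comment> \<open>For the residue r = 2j + 1 this makes k (k - r) t an integer multiple of 2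
      \<pi>, so k^2 t may be replaced by k r t inside the sine.\<close>
    have "(real k - real (2 * j + 1)) * ?t = 2 * pi * real (n * p)"
      using assms by (simp add: k_def)
    moreover have "real k * (y - real (2 * j + 1) * ?t) =
        real k * y - (real k)\<^sup>2 * ?t + real k * ((real k - real (2 * j + 1)) * ?t)"
      by (simp only: left_diff_distrib right_diff_distrib power2_eq_square)
    ultimately have "real k * (y - real (2 * j + 1) * ?t) =
        (real k * y - (real k)\<^sup>2 * ?t) + 2 * pi * real (k * (n * p))"
      by (simp only: of_nat_mult ac_simps)
    then have "sin (real k * (y - real (2 * j + 1) * ?t)) = sin (real k * y - (real k)\<^sup>2 * ?t)"
      by (simp only: sin_plus_2pi_nat)
    moreover have "k > 0" by (simp add: k_def)
    then have "omega_BO (real k) = (real k)\<^sup>2"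
      by (simp add: omega_BO_def)
    ultimately show ?thesis
      unfolding riemann_term_def k k_def[symmetric] by (simp only:)
  qed
  have "(\<Sum>n<M * q. ?f n) = (\<Sum>n<M. sum ?f {n * q..<n * q + q})"
    by (rule sum.nat_group[symmetric])
  also have "\<dots> = (\<Sum>n<M. \<Sum>j<q. ?f (n * q + j))"
  proof (rule sum.cong[OF refl])
    show "sum ?f {n * q..<n * q + q} = (\<Sum>j<q. ?f (n * q + j))" for n
      by (rule sum.reindex_bij_witness[of _ "\<lambda>j. n * q + j" "\<lambda>i. i - n * q"]) auto
  qed
  also have "\<dots> = (\<Sum>j<q. \<Sum>n<M. ?f (n * q + j))"
    by (rule sum.swap)
  finally show ?thesis
    by (simp only: rterm sum_distrib_left)
qed

text \<open>Off the nodes the regrouped partial sums converge pointwise to the hypergeometric sum,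
  while a subsequence of them converges almost everywhere to the solution minus 1/2; the two limits
  must agree.\<close>

lemma BO_solution_rational_time:
  fixes p q :: nat
  assumes u: "periodic_riemann_solution omega_BO u" and "q > 0"
  shows "AE x in lebesgue. u (real p * pi / real q) x =
    1 / 2 + 2 / pi * (\<Sum>j<q. trig_hyp (2 * q) (2 * j + 1) (x - real (2 * j + 1) * (real p * pi / real q)))"
proof -
  let ?t = "real p * pi / real q"
  let ?y = "\<lambda>x j. x - real (2 * j + 1) * ?t"
  have "?t \<ge> 0" by simp
  moreover have "strict_mono (\<lambda>M. M * q)"
    using \<open>q > 0\<close> by (simp add: strict_mono_def)
  ultimately obtain s where s: "strict_mono s"
      and lim: "AE x in lebesgue. (\<lambda>m. \<Sum>n<s m * q. riemann_term omega_BO ?t n x) \<longlonglongrightarrow> u ?t x - 1 / 2"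
    by (rule periodic_riemann_solution_AE_subseq[OF u])
  \<comment> \<open>For each residue 2j + 1 the nodes of the corresponding function are translated
    by (2j + 1) t; the union is countable, hence null.\<close>
  define nodes where "nodes = (\<Union>j<q. range (\<lambda>l::int. 2 * pi * of_int l / real (2 * q) + real (2 * j + 1) * ?t))"
  have "negligible nodes"
    unfolding nodes_def by (intro negligible_of_countable) auto
  then have "AE x in lebesgue. x \<notin> nodes"
    by (simp add: AE_lebesgue_iff_negligible)
  with lim show ?thesis
  proof eventually_elim
    case (elim x)
    have "(\<lambda>M. \<Sum>n<M. sin (real (n * (2 * q) + (2 * j + 1)) * ?y x j) / real (n * (2 * q) + (2 * j + 1)))
        \<longlonglongrightarrow> trig_hyp (2 * q) (2 * j + 1) (?y x j)" if "j < q" for j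
      unfolding trig_hyp_def
    proof (intro summable_LIMSEQ summable_trig_hyp)
      show "?y x j \<noteq> 2 * pi * of_int l / real (2 * q)" for l :: int
      proof
        assume "?y x j = 2 * pi * of_int l / real (2 * q)"
        then have "x = 2 * pi * of_int l / real (2 * q) + real (2 * j + 1) * ?t" by linarith
        with elim(2) that show False unfolding nodes_def by blast
      qed
    qed (use \<open>q > 0\<close> in auto)
    then have "(\<lambda>M. \<Sum>n<M * q. riemann_term omega_BO ?t n x)
        \<longlonglongrightarrow> 2 / pi * (\<Sum>j<q. trig_hyp (2 * q) (2 * j + 1) (?y x j))"
      unfolding sum_riemann_term_BO_rational[OF \<open>q > 0\<close>]
      by (intro tendsto_mult tendsto_const tendsto_sum) (simp only: lessThan_iff)
    from LIMSEQ_subseq_LIMSEQ[OF this s]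
    have "u ?t x - 1 / 2 = 2 / pi * (\<Sum>j<q. trig_hyp (2 * q) (2 * j + 1) (?y x j))"
      using LIMSEQ_unique[OF elim(1)] by (simp only: o_def)
    then show ?case by linarith
  qed
qed

section \<open>The difference of the two solutions\<close>

lemma ILW_minus_BO_AE_sine_series:
  assumes "\<delta> > 0" "t \<ge> 0"
    and u: "periodic_riemann_solution (omega_ILW \<delta>) u"
    and u': "periodic_riemann_solution omega_BO u'"
  obtains A B \<phi> where
    "\<forall>n. \<bar>A n\<bar> \<le> B * exp (- \<delta> * real (2 * n + 1))"
    "AE x in lebesgue. u t x - u' t (x + t / \<delta>) = (\<Sum>n. A n * sin (real (2 * n + 1) * x + \<phi> n))"
proof -
  obtain A B \<phi> where A: "\<And>n. \<bar>A n\<bar> \<le> B * exp (- \<delta> * real (2 * n + 1))"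
    and diff: "\<And>n x. riemann_term (omega_ILW \<delta>) t n x - riemann_term omega_BO t n (x + t / \<delta>)
      = A n * sin (real (2 * n + 1) * x + \<phi> n)"
    using riemann_term_ILW_diff_BO[OF assms(1,2)] by metis
  obtain r where r: "strict_mono r"
    and lim: "AE x in lebesgue. (\<lambda>m. \<Sum>n<id (r m). riemann_term (omega_ILW \<delta>) t n x) \<longlonglongrightarrow> u t x - 1 / 2"
    using periodic_riemann_solution_AE_subseq[OF u \<open>t \<ge> 0\<close> strict_mono_id] .
  \<comment> \<open>The second subsequence is extracted from the first, so that both series converge
    along the common lengths \<open>r (s m)\<close> and may be subtracted term by term.\<close>
  obtain s where s: "strict_mono s"
    and lim': "AE x in lebesgue. (\<lambda>m. \<Sum>n<r (s m). riemann_term omega_BO t n x) \<longlonglongrightarrow> u' t x - 1 / 2"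
    using periodic_riemann_solution_AE_subseq[OF u' \<open>t \<ge> 0\<close> r] .
  have sA: "summable (\<lambda>n. \<bar>A n\<bar>)"
    using summable_exp_decay_power[OF \<open>\<delta> > 0\<close> A, of 0] by simp
  from lim AE_lebesgue_translate[OF lim', of "t / \<delta>"]
  have "AE x in lebesgue. u t x - u' t (x + t / \<delta>) = (\<Sum>n. A n * sin (real (2 * n + 1) * x + \<phi> n))"
  proof eventually_elim
    case (elim x)
    let ?a = "\<lambda>n. A n * sin (real (2 * n + 1) * x + \<phi> n)"
    have "(\<lambda>m. \<Sum>n<r (s m). riemann_term (omega_ILW \<delta>) t n x) \<longlonglongrightarrow> u t x - 1 / 2"
      using LIMSEQ_subseq_LIMSEQ[OF elim(1) s] by (simp only: o_def id_apply)
    from tendsto_diff[OF this elim(2)]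
    have "(\<lambda>m. \<Sum>n<r (s m). ?a n) \<longlonglongrightarrow> u t x - u' t (x + t / \<delta>)"
      unfolding sum_subtractf[symmetric] diff by simp
    moreover have "summable ?a"
      by (rule summable_comparison_test'[OF sA]) (auto simp: abs_mult intro!: mult_left_le)
    \<comment> \<open>The difference series converges absolutely, so its limit along the subsequence
      is its full sum.\<close>
    then have "(\<lambda>m. \<Sum>n<r (s m). ?a n) \<longlonglongrightarrow> suminf ?a"
      using LIMSEQ_subseq_LIMSEQ[OF summable_LIMSEQ strict_mono_o[OF r s], of ?a] by (simp only: o_def)
    ultimately show ?case by (rule LIMSEQ_unique)
  qed
  then show ?thesis
    using A that[of A B \<phi>] by blast
qed

text \<open>The L^2 limits determine both solutions, and hence \<open>v t\<close>, only up to null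
  sets. Smoothness is therefore asserted of a representative \<open>w\<close>, whereas the Fourier
  coefficients are insensitive to the choice.\<close>

theorem mainTheorem2:
  fixes \<delta> :: real and u\<^sub>\<delta> u\<^sub>B\<^sub>O v :: "real \<Rightarrow> real \<Rightarrow> real"
  assumes "\<delta> > 0"
    and "periodic_riemann_solution (omega_ILW \<delta>) u\<^sub>\<delta>"
    and "periodic_riemann_solution omega_BO u\<^sub>B\<^sub>O"
    and "\<And>t x. t \<ge> 0 \<Longrightarrow> u\<^sub>\<delta> t x = u\<^sub>B\<^sub>O t (x + t / \<delta>) + v t x"
  shows "(\<forall>t\<ge>0. exponentially_decaying (fourier_coeff (v t)) \<and>
            (\<exists>w. C_infinity w \<and> (AE x in lebesgue. v t x = w x))) \<and>
         (\<forall>p q :: nat. p > 0 \<longrightarrow> q > 0 \<longrightarrow>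
            (AE x in lebesgue.
               u\<^sub>\<delta> (real p * pi / real q) x - v (real p * pi / real q) x =
                 1 / 2 + 2 / pi * (\<Sum>j<q. trig_hyp (2 * q) (2 * j + 1)
                   (x - real (2 * j + 1) * (real p * pi / real q) + real p * pi / (real q * \<delta>)))))"
proof (intro conjI allI impI)
  fix t :: real assume "t \<ge> 0"
  obtain A B \<phi> where A: "\<forall>n. \<bar>A n\<bar> \<le> B * exp (- \<delta> * real (2 * n + 1))"
    and ae: "AE x in lebesgue. u\<^sub>\<delta> t x - u\<^sub>B\<^sub>O t (x + t / \<delta>) = (\<Sum>n. A n * sin (real (2 * n + 1) * x + \<phi> n))"
    using ILW_minus_BO_AE_sine_series[OF assms(1) \<open>t \<ge> 0\<close> assms(2,3)] .
  let ?w = "\<lambda>x. \<Sum>n. A n * sin (real (2 * n + 1) * x + \<phi> n)"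
  have "u\<^sub>\<delta> t x - u\<^sub>B\<^sub>O t (x + t / \<delta>) = v t x" for x
    using assms(4)[OF \<open>t \<ge> 0\<close>, of x] by linarith
  with ae have v: "AE x in lebesgue. v t x = ?w x"
    by (simp only:)
  have smooth: "C_infinity ?w"
    by (intro C_infinity_sine_series summable_exp_decay_power[OF assms(1) A[rule_format]])
  then show "\<exists>w. C_infinity w \<and> (AE x in lebesgue. v t x = w x)"
    using v by blast
  show "exponentially_decaying (fourier_coeff (v t))"
    unfolding fourier_coeff_cong_AE[OF v continuous_on_C_infinity[OF smooth]]
    by (rule exponentially_decaying_fourier_sine_series[OF assms(1) A[rule_format]])
next
  fix p q :: nat assume "p > 0" "q > 0"
  let ?t = "real p * pi / real q"
  have "?t \<ge> 0" by simp
  then have "u\<^sub>\<delta> ?t x - v ?t x = u\<^sub>B\<^sub>O ?t (x + ?t / \<delta>)" for x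
    using assms(4)[of ?t x] by linarith
  moreover have "x - real (2 * j + 1) * ?t + real p * pi / (real q * \<delta>) = x + ?t / \<delta> - real (2 * j + 1) * ?t" for x j
    unfolding divide_divide_eq_left by linarith
  ultimately show "AE x in lebesgue. u\<^sub>\<delta> ?t x - v ?t x =
      1 / 2 + 2 / pi * (\<Sum>j<q. trig_hyp (2 * q) (2 * j + 1)
        (x - real (2 * j + 1) * ?t + real p * pi / (real q * \<delta>)))"
    using AE_lebesgue_translate[OF BO_solution_rational_time[OF assms(3) \<open>q > 0\<close>, of p], of "?t / \<delta>"]
    by (simp only:)
qed

end
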